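(* Let $G\le S_n$ be transitive. There exists a positive integer $s$ such that $\mathrm{clo}_{5/2}^s(G)=G^{(5/2)}$. Additionally, the blocks of $G$ and of $G^{(5/2)}$ are the same.
   Context: $S_n$ is the symmetric group on the finite set $\mathbb{Z}_n$. Let $G\le S_n$ be transitive. A block of $G$ is a nonempty set $B\subseteq\mathbb{Z}_n$ with $g(B)\cap B\in\{\emptyset,B\}$ for all $g\in G$; the partition $\{g(B):g\in G\}$ is a block system of $G$. A block system is normal if it is the set of orbits of a normal subgroup of $G$. For a block system $\mathcal{B}$, $\mathrm{fix}_G(\mathcal{B})=\{g\in G:g(B)=B\text{ for all }B\in\mathcal{B}\}$. If a group $L$ preserves a set $B$, $L^B$ is the permutation group it induces on $B$. For a normal block system $\mathcal{B}$ of $G$ and $B\in\mathcal{B}$, $\mathrm{WStab}_G(B)$ is the largest subgroup $W\le\mathrm{fix}_G(\mathcal{B})$ such that $W^B=1$ and, for every other $B'\in\mathcal{B}$, $W^{B'}$ is either transitive on $B'$ or trivial (such a largest subgroup exists). Define $B\equiv B'$ iff $\mathrm{WStab}_G(B)=\mathrm{WStab}_G(B')$. The unions of the equivalence classes of $\equiv$ form a block system $\mathcal{E}_{G,\mathcal{B}}$ of $G$, the $\mathcal{B}$-fixer block system of $G$. If $g(X)=X$, $g|_X$ is the permutation equal to $g$ on $X$ and the identity off $X$. $\mathrm{Stab}_G(E)=\{g\in G:g(E)=E\}$. A transitive group $G\le S_n$ is $5/2$-closed if for every transitive $H\le G$, every normal block system $\mathcal{B}$ of $H$, every $E\in\mathcal{E}_{H,\mathcal{B}}$,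 and every $g\in G$ fixing setwise each block of $\mathcal{B}$ contained in $E$, one has $g|_E\in G$. The $5/2$-closure $G^{(5/2)}$ of a transitive $G\le S_n$ is the intersection of all $5/2$-closed subgroups of $S_n$ containing $G$. For transitive $G\le S_n$, $\mathrm{clo}_{5/2}(G)$ is the subgroup of $S_n$ generated by $G$ together with all permutations $\gamma|_E$, where $H\le G$ is a transitive subgroup, $\mathcal{B}$ is a normal block system of $H$, $E\in\mathcal{E}_{H,\mathcal{B}}$, and $\gamma\in\mathrm{Stab}_G(E)$ fixes setwise each block of $\mathcal{B}$ contained in $E$. $\mathrm{clo}_{5/2}^s(G)$ denotes the result of applying $\mathrm{clo}_{5/2}$ $s$ times, starting with $G$ (at each stage, all transitive subgroups and normal block systems of the current group are used). *)

theory Defs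
  imports "HOL-Algebra.Sym_Groups" "HOL-Algebra.Group_Action" "HOL-Combinatorics.Orbits"
begin

(* The n points are {1..n}, as in sym_group n.  A permutation group of degree n is given by its
   carrier, a set G :: (nat => nat) set with subgroup G (sym_group n). *)

definition transitive_on :: "(nat \<Rightarrow> nat) set \<Rightarrow> nat set \<Rightarrow> bool" where
  "transitive_on L X \<longleftrightarrow> (\<forall>x\<in>X. \<forall>y\<in>X. \<exists>g\<in>L. g x = y)"

definition transitive_group :: "nat \<Rightarrow> (nat \<Rightarrow> nat) set \<Rightarrow> bool" where
  "transitive_group n G \<longleftrightarrow> subgroup G (sym_group n) \<and> transitive_on G {1..n}"

definition is_block :: "nat \<Rightarrow> (nat \<Rightarrow> nat) set \<Rightarrow> nat set \<Rightarrow> bool" where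
  "is_block n G B \<longleftrightarrow> B \<noteq> {} \<and> B \<subseteq> {1..n} \<and> (\<forall>g\<in>G. g ` B \<inter> B = {} \<or> g ` B \<inter> B = B)"

definition is_block_system :: "nat \<Rightarrow> (nat \<Rightarrow> nat) set \<Rightarrow> nat set set \<Rightarrow> bool" where
  "is_block_system n G \<B> \<longleftrightarrow> (\<exists>B. is_block n G B \<and> \<B> = {g ` B | g. g \<in> G})"

(* Group_Action.orbits takes the acting group, the set acted on, and the action, which here is
   plain evaluation of permutations. *)
definition is_normal_block_system :: "nat \<Rightarrow> (nat \<Rightarrow> nat) set \<Rightarrow> nat set set \<Rightarrow> bool" where
  "is_normal_block_system n G \<B> \<longleftrightarrow> is_block_system n G \<B> \<and>
     (\<exists>N. N \<lhd> (sym_group n)\<lparr>carrier := G\<rparr> \<and>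
          \<B> = Group_Action.orbits ((sym_group n)\<lparr>carrier := N\<rparr>) {1..n} (\<lambda>g. g))"

definition fixer :: "(nat \<Rightarrow> nat) set \<Rightarrow> nat set set \<Rightarrow> (nat \<Rightarrow> nat) set" where
  "fixer G \<B> = {g \<in> G. \<forall>B\<in>\<B>. g ` B = B}"

definition setwise_stab :: "(nat \<Rightarrow> nat) set \<Rightarrow> nat set \<Rightarrow> (nat \<Rightarrow> nat) set" where
  "setwise_stab G E = {g \<in> G. g ` E = E}"

(* The group L^X induced on X by a group L preserving X; its elements are represented as
   permutations of nat that are the identity off X.  Likewise g|_X is perm_restrict g X. *)
definition induced :: "(nat \<Rightarrow> nat) set \<Rightarrow> nat set \<Rightarrow> (nat \<Rightarrow> nat) set" where
  "induced L X = {perm_restrict g X | g. g \<in> L}"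

definition wstab_cond ::
  "nat \<Rightarrow> (nat \<Rightarrow> nat) set \<Rightarrow> nat set set \<Rightarrow> nat set \<Rightarrow> (nat \<Rightarrow> nat) set \<Rightarrow> bool" where
  "wstab_cond n G \<B> B W \<longleftrightarrow>
     subgroup W (sym_group n) \<and> W \<subseteq> fixer G \<B> \<and> induced W B = {id} \<and>
     (\<forall>B'\<in>\<B> - {B}. transitive_on (induced W B') B' \<or> induced W B' = {id})"

(* The greatest element with respect to inclusion; it exists by wstab_wstab_cond below. *)
definition wstab :: "nat \<Rightarrow> (nat \<Rightarrow> nat) set \<Rightarrow> nat set set \<Rightarrow> nat set \<Rightarrow> (nat \<Rightarrow> nat) set" where
  "wstab n G \<B> B = (GREATEST W. wstab_cond n G \<B> B W)"

definition fixer_block_system :: "nat \<Rightarrow> (nat \<Rightarrow> nat) set \<Rightarrow> nat set set \<Rightarrow> nat set set" where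
  "fixer_block_system n G \<B> =
     {\<Union>{B' \<in> \<B>. wstab n G \<B> B' = wstab n G \<B> B} | B. B \<in> \<B>}"

definition five_half_closed :: "nat \<Rightarrow> (nat \<Rightarrow> nat) set \<Rightarrow> bool" where
  "five_half_closed n G \<longleftrightarrow> transitive_group n G \<and>
     (\<forall>H \<B> E g. transitive_group n H \<and> H \<subseteq> G \<and> is_normal_block_system n H \<B> \<and>
        E \<in> fixer_block_system n H \<B> \<and> g \<in> G \<and> (\<forall>B\<in>\<B>. B \<subseteq> E \<longrightarrow> g ` B = B)
        \<longrightarrow> perm_restrict g E \<in> G)"

definition five_half_closure :: "nat \<Rightarrow> (nat \<Rightarrow> nat) set \<Rightarrow> (nat \<Rightarrow> nat) set" where
  "five_half_closure n G = \<Inter>{K. five_half_closed n K \<and> G \<subseteq> K}"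

definition clo_five_half :: "nat \<Rightarrow> (nat \<Rightarrow> nat) set \<Rightarrow> (nat \<Rightarrow> nat) set" where
  "clo_five_half n G = generate (sym_group n)
     (G \<union> {perm_restrict \<gamma> E | H \<B> E \<gamma>. transitive_group n H \<and> H \<subseteq> G \<and>
             is_normal_block_system n H \<B> \<and> E \<in> fixer_block_system n H \<B> \<and>
             \<gamma> \<in> setwise_stab G E \<and> (\<forall>B\<in>\<B>. B \<subseteq> E \<longrightarrow> \<gamma> ` B = B)})"

lemma induced_trivial_iff:
  "induced L X = {id} \<longleftrightarrow> L \<noteq> {} \<and> (\<forall>g\<in>L. \<forall>x\<in>X. g x = x)"
proof -
  have "perm_restrict g X = id \<longleftrightarrow> (\<forall>x\<in>X. g x = x)" for g :: "nat \<Rightarrow> nat"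
    by (auto simp: perm_restrict_def fun_eq_iff)
  moreover have "induced L X = {id} \<longleftrightarrow> L \<noteq> {} \<and> (\<forall>g\<in>L. perm_restrict g X = id)"
    unfolding induced_def Setcompr_eq_image by (auto simp: image_iff)
  ultimately show ?thesis by simp
qed

lemma transitive_on_induced_iff:
  "transitive_on (induced L X) X \<longleftrightarrow> transitive_on L X"
proof -
  have "(\<exists>k\<in>induced L X. k x = y) \<longleftrightarrow> (\<exists>g\<in>L. g x = y)" if "x \<in> X" for x y
  proof -
    have "perm_restrict g X x = g x" for g :: "nat \<Rightarrow> nat"
      using that by (simp add: perm_restrict_def)
    then show ?thesis unfolding induced_def Setcompr_eq_image by simp
  qed
  then show ?thesis unfolding transitive_on_def by simp
qed

lemma inv_sym_group:
  assumes "g permutes {1..n}"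
  shows "inv\<^bsub>sym_group n\<^esub> g = Hilbert_Choice.inv g"
  using assms
  by (intro group.inv_equality[OF sym_group_is_group])
     (auto simp: sym_group_carrier sym_group_mult sym_group_one permutes_inv permutes_inv_o)

lemma subgroup_pointwise_fixer:
  assumes "subgroup G (sym_group n)"
  shows "subgroup {g \<in> fixer G \<B>. \<forall>x\<in>X. g x = x} (sym_group n)"
proof -
  interpret S: group "sym_group n" by (rule sym_group_is_group)
  have perm: "g permutes {1..n}" if "g \<in> G" for g
    using subgroup.subset[OF assms] that by (auto simp: sym_group_carrier)
  show ?thesis
  proof (rule S.subgroupI)
    show "{g \<in> fixer G \<B>. \<forall>x\<in>X. g x = x} \<subseteq> carrier (sym_group n)"
      using perm by (auto simp: fixer_def sym_group_carrier)
    have "id \<in> G" using subgroup.one_closed[OF assms] by (simp add: sym_group_one)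
    then show "{g \<in> fixer G \<B>. \<forall>x\<in>X. g x = x} \<noteq> {}"
      by (auto simp: fixer_def intro!: exI[of _ id])
  next
    fix g assume g: "g \<in> {g \<in> fixer G \<B>. \<forall>x\<in>X. g x = x}"
    then have gG: "g \<in> G" by (auto simp: fixer_def)
    note p = perm[OF gG]
    have "Hilbert_Choice.inv g \<in> G"
      using subgroup.m_inv_closed[OF assms gG] inv_sym_group[OF p] by simp
    moreover have "Hilbert_Choice.inv g ` B = B" if "B \<in> \<B>" for B
    proof -
      have "g ` B = B" using g that by (simp add: fixer_def)
      then show ?thesis using image_inv_f_f[OF permutes_inj[OF p], of B] by simp
    qed
    moreover have "Hilbert_Choice.inv g x = x" if "x \<in> X" for x
      using g that permutes_inj[OF p] by (auto simp: inv_f_eq)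
    ultimately show "inv\<^bsub>sym_group n\<^esub> g \<in> {g \<in> fixer G \<B>. \<forall>x\<in>X. g x = x}"
      using inv_sym_group[OF p] by (auto simp: fixer_def)
  next
    fix g h
    assume gh: "g \<in> {g \<in> fixer G \<B>. \<forall>x\<in>X. g x = x}"
      "h \<in> {g \<in> fixer G \<B>. \<forall>x\<in>X. g x = x}"
    then have "g \<circ> h \<in> G"
      using subgroup.m_closed[OF assms, of g h] by (simp add: fixer_def sym_group_mult)
    moreover have "(g \<circ> h) ` B = B" if "B \<in> \<B>" for B
      unfolding image_comp[symmetric] using gh that by (simp add: fixer_def)
    moreover have "(g \<circ> h) x = x" if "x \<in> X" for x using gh that by simp
    ultimately show "g \<otimes>\<^bsub>sym_group n\<^esub> h \<in> {g \<in> fixer G \<B>. \<forall>x\<in>X. g x = x}"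
      unfolding sym_group_mult fixer_def by blast
  qed
qed

lemma ex_greatest_wstab_cond:
  assumes G: "subgroup G (sym_group n)"
  shows "\<exists>W. wstab_cond n G \<B> B W \<and> (\<forall>V. wstab_cond n G \<B> B V \<longrightarrow> V \<subseteq> W)"
proof -
  interpret S: group "sym_group n" by (rule sym_group_is_group)
  define U where "U = \<Union>{V. wstab_cond n G \<B> B V}"
  define W where "W = generate (sym_group n) U"
  have UW: "U \<subseteq> W" unfolding W_def by (auto intro: generate.incl)
  have idW: "id \<in> W" unfolding W_def using generate.one[of "sym_group n"]
    by (simp add: sym_group_one)
  have Usub: "U \<subseteq> carrier (sym_group n)"
    unfolding U_def wstab_cond_def using subgroup.subset by blast
  have triv: "W \<subseteq> {g \<in> fixer G \<B>. \<forall>x\<in>X. g x = x}"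
    if "\<And>V. wstab_cond n G \<B> B V \<Longrightarrow> induced V X = {id}" for X
    unfolding W_def
  proof (rule S.generate_subgroup_incl[OF _ subgroup_pointwise_fixer[OF G]])
    show "U \<subseteq> {g \<in> fixer G \<B>. \<forall>x\<in>X. g x = x}"
      using that unfolding U_def induced_trivial_iff by (auto simp: wstab_cond_def)
  qed
  have ind: "induced W X = {id}"
    if "\<And>V. wstab_cond n G \<B> B V \<Longrightarrow> induced V X = {id}" for X
    using triv[OF that] idW unfolding induced_trivial_iff by blast
  have "wstab_cond n G \<B> B W"
    unfolding wstab_cond_def
  proof (intro conjI ballI)
    show "subgroup W (sym_group n)" unfolding W_def by (rule S.generate_is_subgroup[OF Usub])
    show "W \<subseteq> fixer G \<B>" using triv[of B] by (auto simp: wstab_cond_def)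
    show "induced W B = {id}" by (rule ind) (simp add: wstab_cond_def)
    fix B' assume B': "B' \<in> \<B> - {B}"
    show "transitive_on (induced W B') B' \<or> induced W B' = {id}"
    proof (cases "\<forall>V. wstab_cond n G \<B> B V \<longrightarrow> induced V B' = {id}")
      case True then show ?thesis using ind by blast
    next
      case False
      then obtain V where V: "wstab_cond n G \<B> B V" "induced V B' \<noteq> {id}" by blast
      then have "transitive_on V B'"
        using B' by (auto simp: wstab_cond_def transitive_on_induced_iff)
      moreover have "V \<subseteq> W" using V(1) UW unfolding U_def by blast
      ultimately show ?thesis
        unfolding transitive_on_induced_iff by (meson transitive_on_def subsetD)
    qed
  qed
  moreover have "\<forall>V. wstab_cond n G \<B> B V \<longrightarrow> V \<subseteq> W" using UW unfolding U_def by blast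
  ultimately show ?thesis by blast
qed

lemma wstab_wstab_cond:
  assumes "subgroup G (sym_group n)"
  shows "wstab_cond n G \<B> B (wstab n G \<B> B)"
    and "wstab_cond n G \<B> B V \<Longrightarrow> V \<subseteq> wstab n G \<B> B"
proof -
  obtain W where W: "wstab_cond n G \<B> B W" "\<And>V. wstab_cond n G \<B> B V \<Longrightarrow> V \<subseteq> W"
    using ex_greatest_wstab_cond[OF assms] by blast
  then have "wstab n G \<B> B = W" unfolding wstab_def by (intro Greatest_equality) auto
  with W show "wstab_cond n G \<B> B (wstab n G \<B> B)"
    and "wstab_cond n G \<B> B V \<Longrightarrow> V \<subseteq> wstab n G \<B> B" by auto
qed

end

theory Submission
  imports Defs
begin

text \<open>
  Only the preservation of blocks needs an idea. Let \<open>C\<close> be a block of \<open>G\<close> that meets both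
  \<open>E \<in> \<E>\<^bsub>H,\<B>\<^esub>\<close> and its complement, in points of the blocks \<open>B\<close> and \<open>B'\<close> of \<open>\<B>\<close>. Then
  \<open>WStab(B) \<noteq> WStab(B')\<close>. These groups are conjugate in \<open>H\<close>, so they have the same order and each
  acts nontrivially, hence transitively, on the block fixed pointwise by the other. As both have a
  fixed point in \<open>C\<close>, they preserve \<open>C\<close>, and so \<open>B \<union> B' \<subseteq> C\<close>. Thus \<open>C \<inter> E\<close> is a union of
  blocks of \<open>\<B>\<close>, and every \<open>\<gamma>|\<^sub>E\<close> adjoined to \<open>G\<close> preserves \<open>C\<close>.
\<close>

section \<open>Permutation groups and restrictions of permutations\<close>

lemma subgroup_sym_groupD:
  assumes "subgroup G (sym_group n)"
  shows "g \<in> G \<Longrightarrow> g permutes {1..n}"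
    and "id \<in> G"
    and "g \<in> G \<Longrightarrow> h \<in> G \<Longrightarrow> g \<circ> h \<in> G"
    and "g \<in> G \<Longrightarrow> Hilbert_Choice.inv g \<in> G"
proof -
  show p: "g permutes {1..n}" if "g \<in> G" for g
    using subgroup.subset[OF assms] that by (auto simp: sym_group_carrier)
  show "id \<in> G" using subgroup.one_closed[OF assms] by (simp add: sym_group_one)
  show "g \<circ> h \<in> G" if "g \<in> G" "h \<in> G"
    using subgroup.m_closed[OF assms that] by (simp add: sym_group_mult)
  show "Hilbert_Choice.inv g \<in> G" if "g \<in> G"
    using subgroup.m_inv_closed[OF assms that] inv_sym_group[OF p[OF that]] by simp
qed

lemma subgroup_sym_groupI:
  assumes "\<And>g. g \<in> G \<Longrightarrow> g permutes {1..n}"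
    and "id \<in> G"
    and "\<And>g h. g \<in> G \<Longrightarrow> h \<in> G \<Longrightarrow> g \<circ> h \<in> G"
    and "\<And>g. g \<in> G \<Longrightarrow> Hilbert_Choice.inv g \<in> G"
  shows "subgroup G (sym_group n)"
proof (rule group.subgroupI[OF sym_group_is_group])
  show "G \<subseteq> carrier (sym_group n)" using assms(1) by (auto simp: sym_group_carrier)
  show "G \<noteq> {}" using assms(2) by blast
  show "inv\<^bsub>sym_group n\<^esub> g \<in> G" if "g \<in> G" for g
    using inv_sym_group[OF assms(1)[OF that]] assms(4)[OF that] by simp
  show "g \<otimes>\<^bsub>sym_group n\<^esub> h \<in> G" if "g \<in> G" "h \<in> G" for g h
    using assms(3)[OF that] by (simp add: sym_group_mult)
qed

lemma finite_subgroup_sym_group: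
  "subgroup G (sym_group n) \<Longrightarrow> finite G"
  by (rule finite_subset[OF _ finite_permutations[of "{1..n}"]])
     (use subgroup_sym_groupD(1) in blast)+

lemma perm_restrict_permutes_subset:
  assumes "g permutes S" "g ` E = E" "E \<subseteq> S"
  shows "perm_restrict g E permutes S"
proof (rule permutes_subset[OF bij_imp_permutes assms(3)])
  have "inj_on g E" using permutes_inj_on[OF assms(1)] .
  then have "bij_betw g E E" using assms(2) by (simp add: bij_betw_def)
  then show "bij_betw (perm_restrict g E) E E"
    by (rule bij_betw_cong[THEN iffD1, rotated]) (simp add: perm_restrict_def)
qed (simp add: perm_restrict_def)

section \<open>Elementary facts about blocks\<close>

lemma block_image_eq:
  assumes "is_block n G C" "g permutes {1..n}" "g \<in> G" "x \<in> C" "g x \<in> C"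
  shows "g ` C = C"
proof -
  have "finite C" using assms(1) finite_subset unfolding is_block_def by blast
  \<comment> \<open>The point \<open>g x\<close> lies in \<open>C\<close> and in its image, so the
    intersection is all of \<open>C\<close>; equal finite cardinalities turn this inclusion into an
    equality.\<close>
  moreover have "C \<subseteq> g ` C" using assms unfolding is_block_def by blast
  moreover have "card (g ` C) = card C"
    by (rule card_image[OF permutes_inj_on[OF assms(2)]])
  ultimately show ?thesis by (metis card_subset_eq finite_imageI)
qed

lemma block_image:
  assumes G: "subgroup G (sym_group n)" and C: "is_block n G C" and g: "g \<in> G"
  shows "is_block n G (g ` C)"
  unfolding is_block_def
proof (intro conjI ballI)
  note p = subgroup_sym_groupD(1)[OF G]
  show "g ` C \<noteq> {}" using C by (auto simp: is_block_def)
  show "g ` C \<subseteq> {1..n}"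
    using C permutes_image[OF p[OF g]] unfolding is_block_def by blast
  fix h assume h: "h \<in> G"
  \<comment> \<open>The effect of \<open>h\<close> on the image of \<open>C\<close> under
    \<open>g\<close> is the effect of this conjugate on \<open>C\<close>, transported by
    \<open>g\<close>.\<close>
  let ?k = "Hilbert_Choice.inv g \<circ> (h \<circ> g)"
  have "?k \<in> G" using g h by (intro subgroup_sym_groupD[OF G])
  moreover have "h ` g ` C \<inter> g ` C = g ` (?k ` C \<inter> C)"
  proof -
    have "g ` ?k ` C = h ` g ` C"
      by (simp add: image_image permutes_inverses(1)[OF p[OF g]])
    then show ?thesis using permutes_inj[OF p[OF g]] by (simp add: image_Int)
  qed
  moreover have "?k ` C \<inter> C = {} \<or> ?k ` C \<inter> C = C" if "?k \<in> G"
    using C that unfolding is_block_def by blast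
  ultimately show "h ` g ` C \<inter> g ` C = {} \<or> h ` g ` C \<inter> g ` C = g ` C"
    by (elim meta_impE disjE) simp_all
qed

section \<open>Conjugation of wreath stabilizers\<close>

lemma wstab_cond_conjugate:
  assumes H: "subgroup H (sym_group n)" and h: "h \<in> H"
    and inv_sys: "\<And>k B. k \<in> H \<Longrightarrow> B \<in> \<B> \<Longrightarrow> k ` B \<in> \<B>"
    and W: "wstab_cond n H \<B> B W"
  shows "wstab_cond n H \<B> (h ` B) ((\<lambda>w. h \<circ> w \<circ> Hilbert_Choice.inv h) ` W)"
    (is "wstab_cond n H \<B> _ ?V")
proof -
  let ?i = "Hilbert_Choice.inv h"
  note D = subgroup_sym_groupD[OF H]
  have sW: "subgroup W (sym_group n)" and WH: "W \<subseteq> fixer H \<B>" "W \<subseteq> H"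
    and WB: "\<And>w x. w \<in> W \<Longrightarrow> x \<in> B \<Longrightarrow> w x = x"
    and W_cases: "\<And>A. A \<in> \<B> - {B} \<Longrightarrow> transitive_on W A \<or> (\<forall>w\<in>W. \<forall>x\<in>A. w x = x)"
    using W by (auto simp: wstab_cond_def induced_trivial_iff fixer_def transitive_on_induced_iff)
  note DW = subgroup_sym_groupD[OF sW]
  have i: "?i \<in> H" using D(4)[OF h] .
  have bh: "bij h" using permutes_bij[OF D(1)[OF h]] .
  have ih [simp]: "?i (h x) = x" "h (?i x) = x" for x
    using bh by (auto simp: bij_is_inj bij_is_surj surj_f_inv_f)
  have hi: "h ` ?i ` X = X" "?i ` h ` X = X" for X
    by (simp_all add: image_image)
  have conj: "h \<circ> w \<circ> ?i \<in> H" if "w \<in> W" for w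
    using that h i WH(2) by (intro D(3)) auto
  have sV: "subgroup ?V (sym_group n)"
  proof (rule subgroup_sym_groupI)
    show "g permutes {1..n}" if "g \<in> ?V" for g
      using that conj D(1) by blast
    show "id \<in> ?V" using DW(2) by (intro image_eqI[of _ _ id]) (auto simp: fun_eq_iff)
  next
    fix g k assume "g \<in> ?V" "k \<in> ?V"
    then obtain u v where "u \<in> W" "v \<in> W" "g = h \<circ> u \<circ> ?i" "k = h \<circ> v \<circ> ?i" by blast
    then show "g \<circ> k \<in> ?V"
      using DW(3)[of u v] by (intro image_eqI[of _ _ "u \<circ> v"]) (auto simp: fun_eq_iff)
  next
    fix g assume "g \<in> ?V"
    then obtain u where u: "u \<in> W" "g = h \<circ> u \<circ> ?i" by blast
    let ?j = "Hilbert_Choice.inv u"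
    have bu: "bij u" using permutes_bij[OF DW(1)[OF u(1)]] .
    have "Hilbert_Choice.inv g = h \<circ> ?j \<circ> ?i"
      by (rule inv_unique_comp)
         (use bu in \<open>auto simp: u(2) fun_eq_iff bij_is_inj bij_is_surj surj_f_inv_f\<close>)
    then show "Hilbert_Choice.inv g \<in> ?V" using DW(4)[OF u(1)] by blast
  qed
  show ?thesis
    unfolding wstab_cond_def
  proof (intro conjI ballI sV)
    show "?V \<subseteq> fixer H \<B>"
    proof (clarify, unfold fixer_def mem_Collect_eq, intro conjI ballI)
      fix w assume w: "w \<in> W"
      show "h \<circ> w \<circ> ?i \<in> H" using conj[OF w] .
      fix A assume "A \<in> \<B>"
      then have "?i ` A \<in> \<B>" by (rule inv_sys[OF i])
      moreover have "w \<in> fixer H \<B>" using w WH(1) by blast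
      ultimately have "w ` ?i ` A = ?i ` A" unfolding fixer_def by blast
      then show "(h \<circ> w \<circ> ?i) ` A = A" unfolding image_comp[symmetric] by (simp add: hi)
    qed
    show "induced ?V (h ` B) = {id}"
      unfolding induced_trivial_iff
    proof (intro conjI ballI)
      show "?V \<noteq> {}" using DW(2) by blast
      fix g y assume "g \<in> ?V" "y \<in> h ` B"
      then obtain w x where "w \<in> W" "x \<in> B" "g = h \<circ> w \<circ> ?i" "y = h x" by blast
      then show "g y = y" using WB[of w x] by simp
    qed
    fix A assume A: "A \<in> \<B> - {h ` B}"
    \<comment> \<open>The conjugate group acts on \<open>A\<close> as \<open>W\<close> acts on the
      preimage of \<open>A\<close> under \<open>h\<close>. That preimage is a block other than
      \<open>B\<close>, so the dichotomy for \<open>W\<close> applies to it.\<close>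
    then have "?i ` A \<in> \<B> - {B}" using inv_sys[OF i] hi by auto
    then have "transitive_on W (?i ` A) \<or> (\<forall>w\<in>W. \<forall>x\<in>?i ` A. w x = x)"
      by (rule W_cases)
    then show "transitive_on (induced ?V A) A \<or> induced ?V A = {id}"
    proof
      assume t: "transitive_on W (?i ` A)"
      have "\<exists>g\<in>?V. g x = y" if "x \<in> A" "y \<in> A" for x y
      proof -
        have "?i x \<in> ?i ` A" "?i y \<in> ?i ` A" using that by simp_all
        then obtain w where "w \<in> W" "w (?i x) = ?i y"
          using t unfolding transitive_on_def by blast
        then show ?thesis by (intro bexI[of _ "h \<circ> w \<circ> ?i"]) auto
      qed
      then show ?thesis unfolding transitive_on_induced_iff by (simp add: transitive_on_def)
    next
      assume triv: "\<forall>w\<in>W. \<forall>x\<in>?i ` A. w x = x"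
      have "(h \<circ> w \<circ> ?i) x = x" if "w \<in> W" "x \<in> A" for w x
        using bspec[OF bspec[OF triv that(1)] imageI[OF that(2)]] by simp
      then have "\<forall>g\<in>?V. \<forall>x\<in>A. g x = x" by blast
      then show ?thesis unfolding induced_trivial_iff using DW(2) by blast
    qed
  qed
qed

text \<open>Conjugation by \<open>h\<close> is injective and sends the left group to one satisfying
  \<open>wstab_cond\<close> for the moved block, hence into the greatest such group. One inequality
  is enough, because in a block system \<open>h\<close> can be chosen to move any block to any
  other.\<close>

lemma card_wstab_le:
  assumes H: "subgroup H (sym_group n)" and h: "h \<in> H"
    and inv_sys: "\<And>k B. k \<in> H \<Longrightarrow> B \<in> \<B> \<Longrightarrow> k ` B \<in> \<B>"
  shows "card (wstab n H \<B> B) \<le> card (wstab n H \<B> (h ` B))"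
proof -
  let ?c = "\<lambda>w. h \<circ> w \<circ> Hilbert_Choice.inv h"
  note W = wstab_wstab_cond(1)[OF H]
  have bh: "bij h" using permutes_bij[OF subgroup_sym_groupD(1)[OF H h]] .
  have "inj ?c"
  proof
    fix u v assume "?c u = ?c v"
    \<comment> \<open>Evaluating both conjugates at \<open>h x\<close> cancels the inverse of
      \<open>h\<close>.\<close>
    then have "h (u x) = h (v x)" for x
      using bh by (auto simp: fun_eq_iff bij_is_inj dest: spec[of _ "h x"])
    then show "u = v" using bh by (auto simp: fun_eq_iff bij_is_inj inj_eq)
  qed
  then have "card (wstab n H \<B> B) = card (?c ` wstab n H \<B> B)"
    by (metis card_image inj_on_subset subset_UNIV)
  also have "\<dots> \<le> card (wstab n H \<B> (h ` B))"
  proof (rule card_mono)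
    show "finite (wstab n H \<B> (h ` B))"
      using W finite_subgroup_sym_group unfolding wstab_cond_def by blast
    show "?c ` wstab n H \<B> B \<subseteq> wstab n H \<B> (h ` B)"
      by (rule wstab_wstab_cond(2)[OF H wstab_cond_conjugate[OF H h inv_sys W]])
  qed
  finally show ?thesis .
qed

section \<open>Block systems and blocks with different wreath stabilizers\<close>

lemma block_system_invariant:
  assumes H: "subgroup H (sym_group n)" and sys: "is_block_system n H \<B>"
    and k: "k \<in> H" and B: "B \<in> \<B>"
  shows "k ` B \<in> \<B>"
proof -
  obtain B0 where "\<B> = {g ` B0 | g. g \<in> H}" using sys unfolding is_block_system_def by blast
  moreover from this B obtain g where "g \<in> H" "B = g ` B0" by blast
  moreover from this have "k ` B = (k \<circ> g) ` B0" "k \<circ> g \<in> H"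
    using subgroup_sym_groupD(3)[OF H k] by (auto simp: image_comp)
  ultimately show ?thesis by blast
qed

lemma block_system_conjugate:
  assumes H: "subgroup H (sym_group n)" and sys: "is_block_system n H \<B>"
    and B: "B \<in> \<B>" "B' \<in> \<B>"
  shows "\<exists>h\<in>H. B' = h ` B"
proof -
  obtain B0 where "\<B> = {g ` B0 | g. g \<in> H}" using sys unfolding is_block_system_def by blast
  with B obtain g g' where g: "g \<in> H" "B = g ` B0" "g' \<in> H" "B' = g' ` B0" by blast
  have "inj g" using permutes_inj subgroup_sym_groupD(1)[OF H g(1)] by blast
  then have "(g' \<circ> Hilbert_Choice.inv g) ` B = B'" using g
    by (simp add: image_image)
  moreover have "g' \<circ> Hilbert_Choice.inv g \<in> H"
    using g(1,3) by (intro subgroup_sym_groupD(3,4)[OF H])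
  ultimately show ?thesis by metis
qed

lemma block_system_subset:
  assumes H: "subgroup H (sym_group n)" and sys: "is_block_system n H \<B>" and B: "B \<in> \<B>"
  shows "B \<subseteq> {1..n}"
proof -
  obtain B0 where "is_block n H B0" "\<B> = {g ` B0 | g. g \<in> H}"
    using sys unfolding is_block_system_def by blast
  with B obtain g where "g \<in> H" "B = g ` B0" "B0 \<subseteq> {1..n}" unfolding is_block_def by blast
  with permutes_image[OF subgroup_sym_groupD(1)[OF H]] show ?thesis by blast
qed

lemma block_system_cover:
  assumes H: "transitive_group n H" and sys: "is_block_system n H \<B>" and x: "x \<in> {1..n}"
  shows "\<exists>B\<in>\<B>. x \<in> B"
proof -
  obtain B0 where B0: "is_block n H B0" "\<B> = {g ` B0 | g. g \<in> H}"
    using sys unfolding is_block_system_def by blast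
  then obtain b where "b \<in> B0" "b \<in> {1..n}" unfolding is_block_def by blast
  then obtain g where "g \<in> H" "g b = x"
    using H x unfolding transitive_group_def transitive_on_def by blast
  then show ?thesis using B0(2) \<open>b \<in> B0\<close> by blast
qed

text \<open>Without transitivity the group of \<open>B\<close> would be trivial on \<open>B'\<close>
  as well as on \<open>B\<close>. It would then satisfy the condition defining the group of
  \<open>B'\<close> and be contained in it; comparing orders gives equality, against
  \<open>neq\<close>.\<close>

lemma wstab_transitive_of_neq:
  assumes H: "subgroup H (sym_group n)" and sys: "is_block_system n H \<B>"
    and B: "B \<in> \<B>" "B' \<in> \<B>" and neq: "wstab n H \<B> B \<noteq> wstab n H \<B> B'"
  shows "transitive_on (wstab n H \<B> B) B'"
proof (rule ccontr)
  let ?W = "wstab n H \<B> B"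
  assume nt: "\<not> transitive_on ?W B'"
  note W = wstab_wstab_cond(1)[OF H, of \<B> B]
  have "B' \<noteq> B" using neq by blast
  then have "induced ?W B' = {id}"
    using W nt B(2) unfolding wstab_cond_def transitive_on_induced_iff by blast
  then have "wstab_cond n H \<B> B' ?W" using W unfolding wstab_cond_def by blast
  then have "?W \<subseteq> wstab n H \<B> B'" by (rule wstab_wstab_cond(2)[OF H])
  moreover have "card (wstab n H \<B> B') \<le> card ?W"
    using block_system_conjugate[OF H sys B(2,1)]
      card_wstab_le[OF H _ block_system_invariant[OF H sys]] by blast
  moreover have "finite (wstab n H \<B> B')"
    using wstab_wstab_cond(1)[OF H] finite_subgroup_sym_group unfolding wstab_cond_def by blast
  ultimately show False using neq card_seteq by blast
qed

lemma block_absorbs: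
  assumes H: "subgroup H (sym_group n)" and sys: "is_block_system n H \<B>"
    and B: "B \<in> \<B>" "B' \<in> \<B>" and neq: "wstab n H \<B> B \<noteq> wstab n H \<B> B'"
    and C: "is_block n H C" and x: "x \<in> C" "x \<in> B" and y: "y \<in> C" "y \<in> B'"
  shows "B' \<subseteq> C"
proof
  fix z assume "z \<in> B'"
  then obtain w where w: "w \<in> wstab n H \<B> B" "w y = z"
    using wstab_transitive_of_neq[OF H sys B neq] y(2) unfolding transitive_on_def by blast
  moreover have "w \<in> H" "w x = x"
    using w(1) x(2) wstab_wstab_cond(1)[OF H, of \<B> B]
    by (auto simp: wstab_cond_def fixer_def induced_trivial_iff)
  \<comment> \<open>The fixed point \<open>x\<close> in \<open>C\<close> forces \<open>w\<close> to
    preserve the block, so \<open>y\<close> cannot leave \<open>C\<close> while \<open>w\<close>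
    ranges over a group transitive on \<open>B'\<close>.\<close>
  ultimately have "w ` C = C"
    using block_image_eq[OF C subgroup_sym_groupD(1)[OF H]] x(1) by metis
  then show "z \<in> C" using w(2) y(1) by blast
qed

section \<open>Restrictions to blocks of the fixer block system\<close>

lemma fixer_block_union:
  assumes "E \<in> fixer_block_system n H \<B>"
  shows "E = \<Union>{B \<in> \<B>. B \<subseteq> E}"
  using assms unfolding fixer_block_system_def by blast

text \<open>This reconciles two definitions: \<open>clo_five_half\<close> demands that \<gamma>
  stabilize \<open>E\<close>, while \<open>five_half_closed\<close> only demands that the blocks
  inside \<open>E\<close> be fixed. The latter suffices because \<open>E\<close> is their
  union.\<close>

lemma fixer_block_image:
  assumes "E \<in> fixer_block_system n H \<B>" "\<And>B. B \<in> \<B> \<Longrightarrow> B \<subseteq> E \<Longrightarrow> \<gamma> ` B = B"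
  shows "\<gamma> ` E = E"
proof -
  have "\<gamma> ` \<Union>{B \<in> \<B>. B \<subseteq> E} = \<Union>{B \<in> \<B>. B \<subseteq> E}"
    unfolding image_Union using assms(2) by (intro arg_cong[of _ _ Union]) force
  then show ?thesis using fixer_block_union[OF assms(1)] by simp
qed

lemma fixer_block_subset:
  assumes "subgroup H (sym_group n)" "is_block_system n H \<B>" "E \<in> fixer_block_system n H \<B>"
  shows "E \<subseteq> {1..n}"
  using fixer_block_union[OF assms(3)] block_system_subset[OF assms(1,2)] by blast

text \<open>Inside \<open>E\<close> the restriction agrees with \<gamma>, which may move
  \<open>C\<close>. If instead \<open>C\<close> has a point outside \<open>E\<close>, then the part
  of \<open>C\<close> in \<open>E\<close> is a possibly empty union of blocks fixed by \<gamma>, and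
  the rest of \<open>C\<close> is fixed pointwise.\<close>

lemma restrict_block:
  assumes H: "transitive_group n H" and sys: "is_block_system n H \<B>"
    and E: "E \<in> fixer_block_system n H \<B>"
    and stab: "\<And>B. B \<in> \<B> \<Longrightarrow> B \<subseteq> E \<Longrightarrow> \<gamma> ` B = B"
    and C: "is_block n H C"
  shows "perm_restrict \<gamma> E ` C = \<gamma> ` C \<or> perm_restrict \<gamma> E ` C = C"
proof (cases "C \<subseteq> E")
  case True
  then have "perm_restrict \<gamma> E ` C = \<gamma> ` C"
    by (intro image_cong) (auto simp: perm_restrict_def)
  then show ?thesis ..
next
  case False
  have sH: "subgroup H (sym_group n)" using H by (simp add: transitive_group_def)
  obtain y where y: "y \<in> C" "y \<notin> E" using False by blast
  have "y \<in> {1..n}" using y(1) C unfolding is_block_def by blast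
  then obtain B' where B': "B' \<in> \<B>" "y \<in> B'" using block_system_cover[OF H sys] by blast
  obtain B1 where E_eq: "E = \<Union>{B \<in> \<B>. wstab n H \<B> B = wstab n H \<B> B1}"
    using E unfolding fixer_block_system_def by blast
  have union: "\<exists>B\<in>\<B>. x \<in> B \<and> B \<subseteq> C \<inter> E" if x: "x \<in> C" "x \<in> E" for x
  proof -
    obtain B where B: "B \<in> \<B>" "x \<in> B" "wstab n H \<B> B = wstab n H \<B> B1"
      using x(2) unfolding E_eq by blast
    have "wstab n H \<B> B' \<noteq> wstab n H \<B> B" using y(2) B' B(3) unfolding E_eq by blast
    \<comment> \<open>The outside point \<open>y\<close> supplies the fixed point: the group of
      \<open>B'\<close> fixes \<open>y\<close> and moves \<open>x\<close> through all of
      \<open>B\<close>.\<close>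
    then have "B \<subseteq> C" using block_absorbs[OF sH sys B'(1) B(1) _ C y(1) B'(2) x(1) B(2)] by blast
    moreover have "B \<subseteq> E" using B(1,3) unfolding E_eq by blast
    ultimately show ?thesis using B by blast
  qed
  \<comment> \<open>No injectivity of \<gamma> is assumed, so that \<gamma> maps the intersection of
    \<open>C\<close> and \<open>E\<close> into itself and that it does so surjectively are shown
    separately.\<close>
  have 1: "\<gamma> x \<in> C \<inter> E" if "x \<in> C" "x \<in> E" for x
    using union[OF that] stab by blast
  have 2: "\<exists>z\<in>C \<inter> E. \<gamma> z = x" if x: "x \<in> C" "x \<in> E" for x
  proof -
    obtain B where B: "B \<in> \<B>" "x \<in> B" "B \<subseteq> C \<inter> E" using union[OF x] by blast
    then have "x \<in> \<gamma> ` B" using stab by auto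
    then show ?thesis using B(3) by blast
  qed
  have "perm_restrict \<gamma> E ` C = C"
  proof (intro equalityI subsetI)
    show "x \<in> C" if "x \<in> perm_restrict \<gamma> E ` C" for x
      using that 1 by (auto simp: perm_restrict_def)
    show "x \<in> perm_restrict \<gamma> E ` C" if "x \<in> C" for x
      using that 2[of x] by (cases "x \<in> E") (force simp: perm_restrict_def image_iff)+
  qed
  then show ?thesis ..
qed

lemma is_block_mono: "is_block n K C \<Longrightarrow> G \<subseteq> K \<Longrightarrow> is_block n G C"
  unfolding is_block_def by blast

text \<open>This serves as an upper bound for a generated group: once all generators preserve a
  family of sets, so does everything they generate.\<close>

lemma subgroup_preserving_family:
  "subgroup {g. g permutes {1..n} \<and> (`) g ` \<C> = \<C>} (sym_group n)" (is "subgroup ?S _")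
proof (rule subgroup_sym_groupI)
  show "id \<in> ?S" by (simp add: permutes_id)
  show "g \<circ> h \<in> ?S" if "g \<in> ?S" "h \<in> ?S" for g h
  proof -
    have "(`) (g \<circ> h) ` \<C> = (`) g ` (`) h ` \<C>" by (simp add: image_image)
    then show ?thesis using that by (simp add: permutes_compose)
  qed
  show "Hilbert_Choice.inv g \<in> ?S" if g: "g \<in> ?S" for g
  proof -
    have p: "g permutes {1..n}" and eq: "(`) g ` \<C> = \<C>" using g by blast+
    have "(`) (Hilbert_Choice.inv g) ` (`) g ` \<C> = \<C>"
      by (simp add: image_image permutes_inverses(2)[OF p])
    then show ?thesis using permutes_inv[OF p] by (simp add: eq)
  qed
qed simp

section \<open>One application of the operator and its effect on blocks\<close>

definition clo_generators :: "nat \<Rightarrow> (nat \<Rightarrow> nat) set \<Rightarrow> (nat \<Rightarrow> nat) set" where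
  "clo_generators n G = {perm_restrict \<gamma> E | H \<B> E \<gamma>. transitive_group n H \<and> H \<subseteq> G \<and>
     is_normal_block_system n H \<B> \<and> E \<in> fixer_block_system n H \<B> \<and>
     \<gamma> \<in> setwise_stab G E \<and> (\<forall>B\<in>\<B>. B \<subseteq> E \<longrightarrow> \<gamma> ` B = B)}"

lemma clo_five_half_eq: "clo_five_half n G = generate (sym_group n) (G \<union> clo_generators n G)"
  unfolding clo_five_half_def clo_generators_def ..

lemma clo_generatorsE:
  assumes "k \<in> clo_generators n G"
  obtains H \<B> E \<gamma> where "transitive_group n H" "H \<subseteq> G" "is_normal_block_system n H \<B>"
    "is_block_system n H \<B>" "E \<in> fixer_block_system n H \<B>" "E \<subseteq> {1..n}" "\<gamma> \<in> G"
    "\<gamma> ` E = E" "\<forall>B\<in>\<B>. B \<subseteq> E \<longrightarrow> \<gamma> ` B = B" "k = perm_restrict \<gamma> E"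
  using assms unfolding clo_generators_def setwise_stab_def
proof (elim CollectE exE conjE)
  fix H \<B> E \<gamma>
  assume *: "k = perm_restrict \<gamma> E" "transitive_group n H" "H \<subseteq> G"
    "is_normal_block_system n H \<B>" "E \<in> fixer_block_system n H \<B>" "\<gamma> \<in> G" "\<gamma> ` E = E"
    "\<forall>B\<in>\<B>. B \<subseteq> E \<longrightarrow> \<gamma> ` B = B"
  have "is_block_system n H \<B>" using *(4) by (simp add: is_normal_block_system_def)
  moreover from this have "E \<subseteq> {1..n}"
    using fixer_block_subset *(2,5) unfolding transitive_group_def by blast
  ultimately show thesis using * by (intro that[of H \<B> E \<gamma>]) simp_all
qed

lemma clo_generators_permutes:
  assumes G: "subgroup G (sym_group n)" and "k \<in> clo_generators n G"
  shows "k permutes {1..n}"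
proof -
  from assms(2) obtain E \<gamma> where "E \<subseteq> {1..n}" "\<gamma> \<in> G" "\<gamma> ` E = E" "k = perm_restrict \<gamma> E"
    by (rule clo_generatorsE)
  then show ?thesis
    using perm_restrict_permutes_subset[OF subgroup_sym_groupD(1)[OF G]] by blast
qed

text \<open>A block of \<open>G\<close> is a block of each subgroup \<open>H\<close> involved, so
  \<open>restrict_block\<close> applies. Its two outcomes are realized in \<open>G\<close> by
  \<gamma> itself and by the identity.\<close>

lemma clo_generators_block:
  assumes "is_block n G C" and "k \<in> clo_generators n G" and "id \<in> G"
  shows "\<exists>g\<in>G. k ` C = g ` C"
proof -
  from assms(2) obtain H \<B> E \<gamma> where *: "transitive_group n H" "H \<subseteq> G" "is_block_system n H \<B>"
    "E \<in> fixer_block_system n H \<B>" "\<gamma> \<in> G" "\<forall>B\<in>\<B>. B \<subseteq> E \<longrightarrow> \<gamma> ` B = B"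
    "k = perm_restrict \<gamma> E"
    by (rule clo_generatorsE)
  have "k ` C = \<gamma> ` C \<or> k ` C = C"
    unfolding *(7)
    by (rule restrict_block[OF *(1,3,4) _ is_block_mono[OF assms(1) *(2)]]) (use *(6) in blast)
  moreover have "C = id ` C" by simp
  ultimately show ?thesis using *(5) assms(3) by metis
qed

lemma clo_five_half_increasing: "G \<subseteq> clo_five_half n G"
  unfolding clo_five_half_eq by (auto intro: generate.incl)

lemma transitive_group_clo:
  assumes "transitive_group n G"
  shows "transitive_group n (clo_five_half n G)"
proof -
  have G: "subgroup G (sym_group n)" using assms by (simp add: transitive_group_def)
  have "G \<union> clo_generators n G \<subseteq> carrier (sym_group n)"
    using subgroup.subset[OF G] clo_generators_permutes[OF G] by (auto simp: sym_group_carrier)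
  then have "subgroup (clo_five_half n G) (sym_group n)"
    unfolding clo_five_half_eq by (rule group.generate_is_subgroup[OF sym_group_is_group])
  then show ?thesis
    using assms clo_five_half_increasing[of G n]
    unfolding transitive_group_def transitive_on_def by blast
qed

text \<open>The orbit of \<open>C\<close> under \<open>G\<close> is preserved by every generator,
  hence by the generated group. So the new group sends \<open>C\<close> only to sets that
  \<open>G\<close> already sends it to, and the block condition is inherited.\<close>

lemma is_block_clo:
  assumes tG: "transitive_group n G" and C: "is_block n G C"
  shows "is_block n (clo_five_half n G) C"
proof -
  have G: "subgroup G (sym_group n)" using tG by (simp add: transitive_group_def)
  note D = subgroup_sym_groupD[OF G]
  define \<C> where "\<C> = {g ` C | g. g \<in> G}"
  let ?S = "{g. g permutes {1..n} \<and> (`) g ` \<C> = \<C>}"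
  have CC: "C \<in> \<C>" unfolding \<C>_def using D(2) by (auto intro!: exI[of _ id])
  have fin: "finite \<C>"
    unfolding \<C>_def using finite_subgroup_sym_group[OF G] by (simp add: Setcompr_eq_image)
  have trans: "g ` A \<in> \<C>" if A: "A \<in> \<C>" and g: "g \<in> G" for g A
  proof -
    obtain k where "k \<in> G" "A = k ` C" using A unfolding \<C>_def by blast
    then have "g \<circ> k \<in> G" "g ` A = (g \<circ> k) ` C" using D(3)[OF g] by (auto simp: image_comp)
    then show ?thesis unfolding \<C>_def by blast
  qed
  have blk: "is_block n G A" if "A \<in> \<C>" for A
    using that block_image[OF G C] unfolding \<C>_def by blast
  \<comment> \<open>Mapping the orbit into itself suffices: a permutation acts injectively on sets
    and the orbit is finite.\<close>
  have S: "k \<in> ?S" if p: "k permutes {1..n}" and sub: "\<And>A. A \<in> \<C> \<Longrightarrow> k ` A \<in> \<C>" for k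
  proof -
    have "inj_on ((`) k) \<C>"
      using permutes_inj[OF p] by (meson inj_image_eq_iff inj_onI)
    then have "(`) k ` \<C> = \<C>" using sub by (intro endo_inj_surj[OF fin]) auto
    then show ?thesis using p by simp
  qed
  have "G \<union> clo_generators n G \<subseteq> ?S"
  proof
    fix k assume "k \<in> G \<union> clo_generators n G"
    then show "k \<in> ?S"
    proof
      assume "k \<in> G"
      then show ?thesis using S[OF D(1)] trans by blast
    next
      assume k: "k \<in> clo_generators n G"
      \<comment> \<open>The whole orbit must be treated, not only \<open>C\<close>, so that products
        of generators are covered; every member of it is again a block of \<open>G\<close>.\<close>
      have "k ` A \<in> \<C>" if "A \<in> \<C>" for A
        using clo_generators_block[OF blk[OF that] k D(2)] trans[OF that] by auto
      then show ?thesis using S[OF clo_generators_permutes[OF G k]] by blast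
    qed
  qed
  then have "clo_five_half n G \<subseteq> ?S"
    unfolding clo_five_half_eq
    by (rule group.generate_subgroup_incl[OF sym_group_is_group _ subgroup_preserving_family])
  then have img: "k ` C \<in> \<C>" if "k \<in> clo_five_half n G" for k
    using that CC by auto
  show ?thesis
    unfolding is_block_def
  proof (intro conjI ballI)
    show "C \<noteq> {}" "C \<subseteq> {1..n}" using C by (simp_all add: is_block_def)
    fix k assume "k \<in> clo_five_half n G"
    from img[OF this] obtain g where "g \<in> G" "k ` C = g ` C" unfolding \<C>_def by blast
    then show "k ` C \<inter> C = {} \<or> k ` C \<inter> C = C" using C by (simp add: is_block_def)
  qed
qed

section \<open>Iteration and comparison with the closure\<close>

lemma transitive_group_clo_iterate:
  "transitive_group n G \<Longrightarrow> transitive_group n ((clo_five_half n ^^ s) G)"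
  by (induction s) (simp_all add: transitive_group_clo)

lemma clo_iterate_increasing: "G \<subseteq> (clo_five_half n ^^ s) G"
  by (induction s) (use clo_five_half_increasing in auto)

lemma is_block_clo_iterate:
  "transitive_group n G \<Longrightarrow> is_block n G C \<Longrightarrow> is_block n ((clo_five_half n ^^ s) G) C"
  by (induction s) (simp_all add: is_block_clo transitive_group_clo_iterate)

text \<open>Every transitive \<open>H\<close> inside \<open>G\<close> also lies inside
  \<open>K\<close>, so closedness of \<open>K\<close> already supplies each adjoined
  restriction.\<close>

lemma clo_subset_five_half_closed:
  assumes K: "five_half_closed n K" and "G \<subseteq> K"
  shows "clo_five_half n G \<subseteq> K"
  unfolding clo_five_half_eq
proof (rule group.generate_subgroup_incl[OF sym_group_is_group])
  show "subgroup K (sym_group n)"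
    using K by (simp add: five_half_closed_def transitive_group_def)
  have "k \<in> K" if "k \<in> clo_generators n G" for k
  proof -
    from that obtain H \<B> E \<gamma> where *: "transitive_group n H" "H \<subseteq> G"
      "is_normal_block_system n H \<B>" "E \<in> fixer_block_system n H \<B>" "\<gamma> \<in> G"
      "\<forall>B\<in>\<B>. B \<subseteq> E \<longrightarrow> \<gamma> ` B = B" "k = perm_restrict \<gamma> E"
      by (rule clo_generatorsE)
    have "H \<subseteq> K" "\<gamma> \<in> K" using *(2,5) assms(2) by blast+
    with * K show ?thesis unfolding five_half_closed_def by blast
  qed
  then show "G \<union> clo_generators n G \<subseteq> K" using assms(2) by blast
qed

lemma five_half_closed_of_fixpoint:
  assumes "transitive_group n K" and "clo_five_half n K = K"
  shows "five_half_closed n K"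
  unfolding five_half_closed_def
proof (intro conjI allI impI assms(1), elim conjE)
  fix H \<B> E g
  assume *: "transitive_group n H" "H \<subseteq> K" "is_normal_block_system n H \<B>"
    "E \<in> fixer_block_system n H \<B>" "g \<in> K" "\<forall>B\<in>\<B>. B \<subseteq> E \<longrightarrow> g ` B = B"
  have "g ` E = E" by (rule fixer_block_image[OF *(4)]) (use *(6) in blast)
  then have "g \<in> setwise_stab K E" using *(5) by (simp add: setwise_stab_def)
  with * have "perm_restrict g E \<in> clo_generators n K" unfolding clo_generators_def by blast
  then have "perm_restrict g E \<in> clo_five_half n K"
    unfolding clo_five_half_eq by (auto intro: generate.incl)
  then show "perm_restrict g E \<in> K" using assms(2) by simp
qed

lemma clo_iterate_stabilizes:
  assumes "transitive_group n G"
  shows "\<exists>s. clo_five_half n ((clo_five_half n ^^ s) G) = (clo_five_half n ^^ s) G"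
proof -
  let ?L = "\<lambda>s. (clo_five_half n ^^ s) G"
  have sub: "subgroup (?L s) (sym_group n)" for s
    using transitive_group_clo_iterate[OF assms] by (simp add: transitive_group_def)
  \<comment> \<open>All stages lie in the finite symmetric group, so some stage has greatest
    cardinality. The successor turns the bound into the strict one required by
    \<open>ex_has_greatest_nat\<close>.\<close>
  have "\<forall>s. True \<longrightarrow> card (?L s) < Suc (card {p. p permutes {1..n}})"
    using subgroup_sym_groupD(1)[OF sub]
    by (auto simp: less_Suc_eq_le intro!: card_mono finite_permutations)
  from ex_has_greatest_nat[of "\<lambda>_. True", OF _ this]
  obtain s where s: "\<And>t. card (?L t) \<le> card (?L s)" by blast
  have "?L s = ?L (Suc s)"
  proof (rule card_seteq)
    show "finite (?L (Suc s))" by (rule finite_subgroup_sym_group[OF sub])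
    show "?L s \<subseteq> ?L (Suc s)" using clo_five_half_increasing by simp
  qed (rule s)
  then show ?thesis by (intro exI[of _ s]) simp
qed

text \<open>A stable stage is closed and contains \<open>G\<close>, so it is one of the groups being
  intersected. Conversely, each of those groups contains every stage, by induction.\<close>

lemma five_half_closure_eq_iterate:
  assumes "transitive_group n G"
    and "clo_five_half n ((clo_five_half n ^^ s) G) = (clo_five_half n ^^ s) G"
  shows "five_half_closure n G = (clo_five_half n ^^ s) G"
proof
  have "five_half_closed n ((clo_five_half n ^^ s) G)"
    using assms transitive_group_clo_iterate five_half_closed_of_fixpoint by blast
  then show "five_half_closure n G \<subseteq> (clo_five_half n ^^ s) G"
    unfolding five_half_closure_def using clo_iterate_increasing by blast
  have "(clo_five_half n ^^ t) G \<subseteq> K" if "five_half_closed n K" "G \<subseteq> K" for K t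
    by (induction t) (use that clo_subset_five_half_closed in auto)
  then show "(clo_five_half n ^^ s) G \<subseteq> five_half_closure n G"
    unfolding five_half_closure_def by blast
qed

theorem theorem2p4:
  fixes n :: nat and G :: "(nat \<Rightarrow> nat) set"
  assumes "transitive_group n G"
  shows "(\<exists>s::nat. s > 0 \<and> (clo_five_half n ^^ s) G = five_half_closure n G) \<and>
         {B. is_block n G B} = {B. is_block n (five_half_closure n G) B}"
proof -
  obtain s where s: "clo_five_half n ((clo_five_half n ^^ s) G) = (clo_five_half n ^^ s) G"
    using clo_iterate_stabilizes[OF assms] by blast
  note eq = five_half_closure_eq_iterate[OF assms s]
  \<comment> \<open>The stable stage may be \<open>s = 0\<close>; passing to its successor makes the
    exponent positive without changing the group.\<close>
  have "(clo_five_half n ^^ Suc s) G = five_half_closure n G" using s eq by simp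
  \<comment> \<open>Blocks survive each application of the operator, and they descend from the
    closure because it contains \<open>G\<close>.\<close>
  moreover have "is_block n G B \<longleftrightarrow> is_block n (five_half_closure n G) B" for B
    unfolding eq using is_block_clo_iterate[OF assms] is_block_mono clo_iterate_increasing by blast
  ultimately show ?thesis by blast
qed

end
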